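(* Let $m\ge3$, $\Omega_m=\{e^{2\pi\mathrm{i}q/m}:q=0,\dots,m-1\}$, $\mathcal{X}=\Omega_m^n\subset\mathbb{C}^n$, and $B\in\mathbb{C}^{n\times r}$. Let $P_B=B^*\operatorname{conv}(\Omega_m^n)\subseteq\mathbb{C}^r\cong\mathbb{R}^{2r}$ and let $d\le2r$ be its real dimension. Then $$|\operatorname{vert}(P_B)|\le R_{\mathrm c}(mn,d)=O((mn)^{d-1}),$$ the asymptotic estimate being for fixed $d\ge1$. For fixed $m$ and complex rank $r$, this is $O(n^{2r-1})$. For complex rank one ($r=1$), an angular sweep uses at most $mn$ phase events: as the direction $z$ traverses the unit circle in $\mathbb{C}$, there are at most $mn$ angles at which the solution of the linear problem $\max_{x\in\Omega_m^n}\operatorname{Re}(\overline{z}\,B^*x)$ (computed by coordinatewise phase quantization) changes.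
   Context: $\mathbb{C}^r$ is identified with $\mathbb{R}^{2r}$ by $y\mapsto(\operatorname{Re}y,\operatorname{Im}y)$ with real inner product $\operatorname{Re}(z^*y)$; convex hulls and vertices are taken over the reals. $B^*$ is the conjugate transpose, and $\operatorname{vert}(P_B)$ is the vertex set of the polytope $P_B$. $R_{\mathrm c}(N,d)=1$ if $d=0$ or $N=0$, and $R_{\mathrm c}(N,d)=2\sum_{j=0}^{d-1}\binom{N-1}{j}$ if $d\ge1$ and $N\ge1$. In the rank-one sweep, coordinates $i$ whose entry of $B$ is zero have no effect on the linear objective and generate no event. *)

theory Defs
  imports "HOL-Analysis.Analysis" "HOL-Analysis.Finite_Function_Topology" "HOL-Library.Landau_Symbols"
begin

text \<open>
  The row count \<open>n\<close> has to be quantified inside the statement (the estimate for fixed \<open>m\<close> and \<open>r\<close>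
  is uniform in \<open>B\<close> as \<open>n\<close> grows), so it is not a type. The space of complex \<open>n\<close>-vectors is the
  subspace of the real vector space of finitely supported functions \<open>nat \<Rightarrow>\<^sub>0 complex\<close> whose
  members vanish outside \<open>{..<n}\<close>. An \<open>n \<times> r\<close> matrix is given by its rows
  \<open>B 0, \<dots>, B (n - 1)\<close>; the values of \<open>B\<close> at indices \<open>\<ge> n\<close> are never used.

  The space \<open>complex ^ 'r\<close> carries the real inner product
  \<open>y \<bullet> z = (\<Sum>j. Re (cnj (y $ j) * z $ j))\<close>, which is the one of its identification with
  real \<open>2r\<close>-space; \<^const>\<open>hull\<close> with \<^const>\<open>convex\<close>, \<^const>\<open>extreme_point_of\<close> and
  \<^const>\<open>aff_dim\<close> are all taken over the reals.
\<close>

type_synonym 'r rows = "nat \<Rightarrow> complex ^ 'r"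

definition roots_of_unity :: "nat \<Rightarrow> complex set" where
  "roots_of_unity m = {exp (2 * of_real pi * \<i> * of_nat q / of_nat m) | q. q < m}"

definition alphabet_power :: "nat \<Rightarrow> nat \<Rightarrow> (nat \<Rightarrow>\<^sub>0 complex) set" where
  "alphabet_power m n =
     {x. (\<forall>i<n. Poly_Mapping.lookup x i \<in> roots_of_unity m) \<and>
         (\<forall>i\<ge>n. Poly_Mapping.lookup x i = 0)}"

definition conj_transpose_mult :: "nat \<Rightarrow> 'r::finite rows \<Rightarrow> (nat \<Rightarrow>\<^sub>0 complex) \<Rightarrow> complex ^ 'r" where
  "conj_transpose_mult n B x = (\<chi> j. \<Sum>i<n. cnj (B i $ j) * Poly_Mapping.lookup x i)"

definition projected_polytope :: "nat \<Rightarrow> nat \<Rightarrow> 'r::finite rows \<Rightarrow> (complex ^ 'r) set" where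
  "projected_polytope m n B = conj_transpose_mult n B ` (convex hull (alphabet_power m n))"

definition vertices :: "'a::real_vector set \<Rightarrow> 'a set" where
  "vertices P = {v. v extreme_point_of P}"

definition real_dim :: "'a::euclidean_space set \<Rightarrow> nat" where
  "real_dim P = nat (aff_dim P)"

definition R_c :: "nat \<Rightarrow> nat \<Rightarrow> nat" where
  "R_c N d = (if d = 0 \<or> N = 0 then 1 else 2 * (\<Sum>j<d. (N - 1) choose j))"

definition linear_maximizers :: "nat \<Rightarrow> nat \<Rightarrow> 1 rows \<Rightarrow> complex \<Rightarrow> (nat \<Rightarrow>\<^sub>0 complex) set" where
  "linear_maximizers m n B z =
     {x \<in> alphabet_power m n. \<forall>y \<in> alphabet_power m n.
        Re (cnj z * conj_transpose_mult n B y $ 1) \<le> Re (cnj z * conj_transpose_mult n B x $ 1)}"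

text \<open>
  \<open>Q w\<close> is a root of unity nearest to \<open>w\<close> in phase: for \<open>w \<noteq> 0\<close> and \<open>\<bar>\<omega>\<bar> = 1\<close>, the number
  \<open>\<bar>Arg (w * cnj \<omega>)\<bar>\<close> is the angular distance of \<open>w\<close> and \<open>\<omega>\<close>. Ties may be broken in any way.
  Since \<open>Arg 0 = 0\<close>, the value \<open>Q 0\<close> may be any root of unity.
\<close>

definition phase_quantizer :: "nat \<Rightarrow> (complex \<Rightarrow> complex) \<Rightarrow> bool" where
  "phase_quantizer m Q \<longleftrightarrow>
     (\<forall>w. Q w \<in> roots_of_unity m \<and>
          (\<forall>\<omega> \<in> roots_of_unity m. \<bar>Arg (w * cnj (Q w))\<bar> \<le> \<bar>Arg (w * cnj \<omega>)\<bar>))"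

text \<open>
  The objective is \<open>(\<Sum>i<n. Re (cnj (z * B i $ 1) * x i))\<close>, hence the argument \<open>z * B i $ 1\<close> below.
  It is \<open>0\<close> for all \<open>z\<close> if \<open>B i $ 1 = 0\<close>, so such a coordinate never changes.
\<close>

definition quantized_solution ::
    "(complex \<Rightarrow> complex) \<Rightarrow> nat \<Rightarrow> 1 rows \<Rightarrow> complex \<Rightarrow> (nat \<Rightarrow>\<^sub>0 complex)" where
  "quantized_solution Q n B z =
     Poly_Mapping.Abs_poly_mapping (\<lambda>i. if i < n then Q (z * B i $ 1) else 0)"

text \<open>
  The angles, modulo \<open>2 * pi\<close>, at which a function of the direction changes as the direction
  traverses the unit circle: those around which it is not locally constant.
\<close>

definition phase_events :: "(complex \<Rightarrow> 'a) \<Rightarrow> real set" where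
  "phase_events f = {\<theta> \<in> {0..<2 * pi}. \<not> (\<forall>\<^sub>F \<phi> in nhds \<theta>. f (cis \<phi>) = f (cis \<theta>))}"

end

theory Submission
  imports Defs
begin

text \<open>
  A vertex of the polytope is the unique maximizer of a linear functional \<open>c\<close>, which can be taken in
  the span of the differences of points of the polytope and orthogonal to none of the at most \<open>m * n\<close>
  nonzero vectors \<open>B\<^sup>* (\<omega>' - \<omega>) e\<^sub>i\<close> with \<open>\<omega>\<close>, \<open>\<omega>'\<close> consecutive roots of unity. The signs of \<open>c\<close> on
  these vectors determine the vertex, because a local maximum of a linear functional along a regular
  polygon is global. So the vertices are no more numerous than the regions of a central hyperplane
  arrangement, and deletion and restriction give Pascal's recursion for their number.

  In the rank-one sweep an event at angle \<open>\<theta>\<close> forces two roots of unity to tie for some coordinate with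
  weight \<open>w = e\<^sup>i\<^sup>\<theta> b\<^sub>i \<noteq> 0\<close>. Then \<open>w\<close> points midway between two consecutive roots, so that
  \<open>w\<^sup>m = - \<bar>w\<bar>\<^sup>m\<close>, which has only \<open>m\<close> solutions \<open>\<theta>\<close> in \<open>[0, 2\<pi>)\<close>.
\<close>

subsection \<open>Regions of a central hyperplane arrangement\<close>

lemma R_c_pos: "1 \<le> R_c N d"
proof (cases "d = 0 \<or> N = 0")
  case False
  then have "(N - 1) choose 0 \<le> (\<Sum>j<d. (N - 1) choose j)"
    by (intro member_le_sum) auto
  then show ?thesis
    using False by (simp add: R_c_def)
qed (auto simp: R_c_def)

lemma R_c_mono:
  assumes "M \<le> N"
  shows "R_c M d \<le> R_c N d"
proof (cases "d = 0 \<or> M = 0")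
  case True
  then have "R_c M d = 1"
    by (auto simp: R_c_def)
  then show ?thesis
    using R_c_pos by simp
next
  case False
  have "(\<Sum>j<d. (M - 1) choose j) \<le> (\<Sum>j<d. (N - 1) choose j)"
    using assms by (intro sum_mono binomial_right_mono) auto
  then show ?thesis
    using False assms by (simp add: R_c_def)
qed

text \<open>Pascal's rule summed over \<open>j\<close>, the term \<open>j = 0\<close> belonging to
  the first sum only. At \<open>d = 0\<close> the identity fails, because \<open>R_c N 0\<close> is
  \<open>1\<close> by convention and not an empty sum.\<close>

lemma R_c_Suc_Suc:
  assumes "N \<ge> 1" "d \<ge> 1"
  shows "R_c (Suc N) (Suc d) = R_c N (Suc d) + R_c N d"
proof -
  obtain M where M: "N = Suc M"
    using assms by (cases N) auto
  have "(\<Sum>j<Suc d. N choose j) = (\<Sum>j<Suc d. M choose j) + (\<Sum>j<d. M choose j)"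
    unfolding M by (simp add: sum.lessThan_Suc_shift sum.distrib del: sum.lessThan_Suc)
  then show ?thesis
    using assms by (simp add: R_c_def M del: sum.lessThan_Suc)
qed

text \<open>Each of the \<open>d\<close> binomials is at most \<open>N ^ (d - 1)\<close>. The factor
  \<open>Suc d\<close> in place of \<open>d\<close> covers \<open>d = 0\<close>, where
  \<open>R_c N 0 = 1\<close>.\<close>

lemma R_c_le_power:
  assumes "N \<ge> 1"
  shows "real (R_c N d) \<le> 2 * real (Suc d) * real N ^ (d - 1)"
proof (cases "d = 0")
  case False
  have "((N - 1) choose j) \<le> N ^ (d - 1)" if "j < d" for j
  proof -
    have "((N - 1) choose j) \<le> N choose j"
      by (intro binomial_right_mono) auto
    also have "\<dots> \<le> N ^ j"
      by (cases "j \<le> N") (auto simp: binomial_le_pow binomial_eq_0)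
    also have "\<dots> \<le> N ^ (d - 1)"
      using assms that by (intro power_increasing) auto
    finally show ?thesis .
  qed
  then have "(\<Sum>j<d. (N - 1) choose j) \<le> d * N ^ (d - 1)"
    using sum_bounded_above[of "{..<d}" "\<lambda>j. (N - 1) choose j" "N ^ (d - 1)"] by simp
  then have "R_c N d \<le> 2 * Suc d * N ^ (d - 1)"
    using False assms by (auto simp: R_c_def)
  then show ?thesis
    by (metis of_nat_le_iff of_nat_mult of_nat_numeral of_nat_power)
qed (auto simp: R_c_def)

text \<open>Each region cut out in \<open>S\<close> by the hyperplanes orthogonal to the
  \<open>a k\<close> is encoded by the indices on whose positive side it lies. Points on a
  hyperplane belong to no region.\<close>

definition sign_patterns :: "('k \<Rightarrow> 'a::real_inner) \<Rightarrow> 'a set \<Rightarrow> 'k set \<Rightarrow> 'k set set" where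
  "sign_patterns a S K = (\<lambda>c. {k \<in> K. 0 < a k \<bullet> c}) ` {c \<in> S. \<forall>k\<in>K. a k \<bullet> c \<noteq> 0}"

lemma sign_patterns_subset_Pow: "sign_patterns a S K \<subseteq> Pow K"
  by (auto simp: sign_patterns_def)

lemma finite_sign_patterns: "finite K \<Longrightarrow> finite (sign_patterns a S K)"
  by (meson finite_Pow_iff finite_subset sign_patterns_subset_Pow)

lemma sign_patterns_empty:
  assumes "k \<in> K" "\<And>c. c \<in> S \<Longrightarrow> a k \<bullet> c = 0"
  shows "sign_patterns a S K = {}"
  using assms by (auto simp: sign_patterns_def)

text \<open>
  A region cut in two by the hyperplane of \<open>k\<close> meets that hyperplane: take the point where the segment
  between the two halves crosses it.
\<close>

lemma sign_patterns_split:
  assumes "subspace S" "k \<notin> K" "X \<in> sign_patterns a S (insert k K)"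
    "insert k X \<in> sign_patterns a S (insert k K)" "k \<notin> X"
  shows "X \<in> sign_patterns a (S \<inter> {c. a k \<bullet> c = 0}) K"
proof -
  from assms(3) obtain c where c: "c \<in> S" "\<And>j. j \<in> insert k K \<Longrightarrow> a j \<bullet> c \<noteq> 0"
    "X = {j \<in> insert k K. 0 < a j \<bullet> c}"
    by (auto simp: sign_patterns_def)
  from assms(4) obtain e where e: "e \<in> S" "\<And>j. j \<in> insert k K \<Longrightarrow> a j \<bullet> e \<noteq> 0"
    "insert k X = {j \<in> insert k K. 0 < a j \<bullet> e}"
    by (auto simp: sign_patterns_def)
  \<comment> \<open>Unnormalized weights of the crossing point: \<open>a k\<close> takes the value
    \<open>- q\<close> at \<open>c\<close> and \<open>p\<close> at \<open>e\<close>, hence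
    \<open>0\<close> at \<open>p *\<^sub>R c + q *\<^sub>R e\<close>.\<close>
  define p where "p = a k \<bullet> e"
  define q where "q = - (a k \<bullet> c)"
  have "k \<in> insert k X"
    by simp
  then have p: "p > 0"
    unfolding e(3) p_def by simp
  have "a k \<bullet> c \<le> 0"
    using \<open>k \<notin> X\<close> unfolding c(3) by auto
  then have q: "q > 0"
    using c(2)[of k] by (simp add: q_def)
  let ?u = "p *\<^sub>R c + q *\<^sub>R e"
  have u: "a j \<bullet> ?u = p * (a j \<bullet> c) + q * (a j \<bullet> e)" for j
    by (simp add: inner_add_right)
  have pos: "0 < a j \<bullet> ?u" if "j \<in> X" for j
  proof -
    have "0 < a j \<bullet> c"
      using that unfolding c(3) by simp
    moreover have "j \<in> insert k X"
      using that by simp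
    then have "0 < a j \<bullet> e"
      unfolding e(3) by simp
    ultimately show ?thesis
      unfolding u using p q by (intro add_pos_pos mult_pos_pos)
  qed
  have neg: "a j \<bullet> ?u < 0" if "j \<in> K" "j \<notin> X" for j
  proof -
    have "a j \<bullet> c < 0"
      using that c(2)[of j] unfolding c(3) by fastforce
    moreover have "j \<notin> insert k X"
      using that \<open>k \<notin> K\<close> by auto
    then have "a j \<bullet> e < 0"
      using that e(2)[of j] unfolding e(3) by fastforce
    ultimately show ?thesis
      unfolding u using p q by (simp add: add_neg_neg mult_pos_neg)
  qed
  have "a k \<bullet> ?u = 0"
    unfolding u by (simp add: p_def q_def)
  moreover have "?u \<in> S"
    using assms(1) c(1) e(1) by (intro subspace_add subspace_scale)
  moreover have "\<forall>j\<in>K. a j \<bullet> ?u \<noteq> 0"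
    using pos neg by force
  moreover have "X \<subseteq> K"
    using \<open>k \<notin> X\<close> c(3) by auto
  then have "X = {j \<in> K. 0 < a j \<bullet> ?u}"
    using pos neg by force
  ultimately show ?thesis
    unfolding sign_patterns_def by blast
qed

text \<open>Deletion and restriction: \<open>P0\<close> holds the patterns without \<open>k\<close>,
  \<open>P1\<close> those with \<open>k\<close>, erased. Their union consists of patterns of the
  arrangement without \<open>k\<close>; their intersection comes from regions that the hyperplane of
  \<open>k\<close> cuts in two, hence from patterns of the restriction.\<close>

lemma card_sign_patterns_insert:
  assumes "finite K" "k \<notin> K" "subspace S"
  shows "card (sign_patterns a S (insert k K))
    \<le> card (sign_patterns a S K) + card (sign_patterns a (S \<inter> {c. a k \<bullet> c = 0}) K)"
proof -
  define P0 where "P0 = {X \<in> sign_patterns a S (insert k K). k \<notin> X}"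
  define P1 where "P1 = {X. k \<notin> X \<and> insert k X \<in> sign_patterns a S (insert k K)}"
  have "sign_patterns a S (insert k K) \<subseteq> P0 \<union> insert k ` P1"
  proof
    fix X assume X: "X \<in> sign_patterns a S (insert k K)"
    show "X \<in> P0 \<union> insert k ` P1"
    proof (cases "k \<in> X")
      case True
      then have "X - {k} \<in> P1" "X = insert k (X - {k})"
        using X by (auto simp: P1_def insert_absorb)
      then show ?thesis
        by blast
    qed (use X in \<open>auto simp: P0_def\<close>)
  qed
  moreover have sub: "P0 \<union> P1 \<subseteq> sign_patterns a S K"
  proof -
    have "X - {k} \<in> sign_patterns a S K" if "X \<in> sign_patterns a S (insert k K)" for X
    proof -
      from that obtain c where c: "c \<in> S" "\<And>j. j \<in> insert k K \<Longrightarrow> a j \<bullet> c \<noteq> 0"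
        "X = {j \<in> insert k K. 0 < a j \<bullet> c}"
        by (auto simp: sign_patterns_def)
      then have "X - {k} = {j \<in> K. 0 < a j \<bullet> c}"
        using \<open>k \<notin> K\<close> by auto
      then show ?thesis
        using c(1,2) unfolding sign_patterns_def by blast
    qed
    from this[of "insert k _"] this show ?thesis
      by (force simp: P0_def P1_def)
  qed
  moreover have fin: "finite (sign_patterns a S K)"
    using assms(1) by (rule finite_sign_patterns)
  ultimately have "card (sign_patterns a S (insert k K)) \<le> card P0 + card P1"
  proof -
    assume sub1: "sign_patterns a S (insert k K) \<subseteq> P0 \<union> insert k ` P1"
      and "P0 \<union> P1 \<subseteq> sign_patterns a S K" "finite (sign_patterns a S K)"
    then have "finite P0" "finite P1"
      by (meson finite_subset le_sup_iff)+
    then have "card (sign_patterns a S (insert k K)) \<le> card (P0 \<union> insert k ` P1)"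
      using sub1 by (intro card_mono) auto
    also have "\<dots> \<le> card P0 + card (insert k ` P1)"
      by (rule card_Un_le)
    also have "card (insert k ` P1) \<le> card P1"
      using \<open>finite P1\<close> by (rule card_image_le)
    finally show ?thesis
      by simp
  qed
  also have "\<dots> = card (P0 \<union> P1) + card (P0 \<inter> P1)"
    using sub fin by (intro card_Un_Int) (auto dest: finite_subset)
  also have "card (P0 \<union> P1) \<le> card (sign_patterns a S K)"
    using sub fin by (rule card_mono[rotated])
  also have "P0 \<inter> P1 \<subseteq> sign_patterns a (S \<inter> {c. a k \<bullet> c = 0}) K"
    using sign_patterns_split[OF assms(3,2)] by (auto simp: P0_def P1_def)
  then have "card (P0 \<inter> P1) \<le> card (sign_patterns a (S \<inter> {c. a k \<bullet> c = 0}) K)"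
    using assms(1) by (intro card_mono finite_sign_patterns)
  finally show ?thesis
    by simp
qed

text \<open>Induction by deletion and restriction, with \<open>S\<close> arbitrary because the
  restriction passes to the subspace \<open>?H\<close>; Pascal's recursion adds the two
  bounds.\<close>

lemma card_sign_patterns_le:
  fixes a :: "'k \<Rightarrow> 'a::euclidean_space"
  assumes "finite K" "subspace S"
  shows "card (sign_patterns a S K) \<le> R_c (card K) (dim S)"
  using assms
proof (induction K arbitrary: S rule: finite_induct)
  case empty
  have "card (sign_patterns a S {}) \<le> card {{} :: 'k set}"
    by (intro card_mono) (auto simp: sign_patterns_def)
  then show ?case
    by (simp add: R_c_def)
next
  case (insert k K)
  let ?H = "S \<inter> {c. a k \<bullet> c = 0}"
  show ?case
  proof (cases "\<forall>c\<in>S. a k \<bullet> c = 0")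
    case True
    then have "sign_patterns a S (insert k K) = {}"
      by (intro sign_patterns_empty[of k]) auto
    then show ?thesis
      by simp
  next
    case False
    have subH: "subspace ?H"
      using insert.prems subspace_hyperplane by (intro subspace_inter)
    have "?H \<subset> S"
      using False by auto
    then have "dim ?H < dim S"
      using subH insert.prems by (intro dim_psubset) (metis span_eq_iff)
    then obtain d where d: "dim S = Suc d" "dim ?H \<le> d"
      by (cases "dim S") auto
    show ?thesis
    proof (cases "K = {}")
      case True
      \<comment> \<open>A single hyperplane allows only \<open>{}\<close> and \<open>{k}\<close>, in
        agreement with \<open>R_c 1 (Suc d) = 2\<close>; the recursion starts from there.\<close>
      have "card (sign_patterns a S (insert k K)) \<le> card (Pow {k})"
        using sign_patterns_subset_Pow[of a S "insert k K"] True by (intro card_mono) auto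
      also have "\<dots> = 2"
        by (simp add: card_Pow)
      also have "\<dots> \<le> R_c (card (insert k K)) (dim S)"
        using True d sum.lessThan_Suc_shift[of "\<lambda>j. 0 choose j" d] by (simp add: R_c_def)
      finally show ?thesis .
    next
      case nonempty: False
      then have N: "card K \<ge> 1"
        using insert.hyps by (simp add: Suc_le_eq card_gt_0_iff)
      have S: "card (sign_patterns a S K) \<le> R_c (card K) (Suc d)"
        using insert.IH[OF insert.prems] d by simp
      \<comment> \<open>For \<open>d = 0\<close> the restriction must contribute nothing, since the
        convention \<open>R_c N 0 = 1\<close> would overshoot. Indeed \<open>?H\<close> is then
        \<open>{0}\<close>, and as \<open>K\<close> is nonempty its only point lies on a
        hyperplane.\<close>
      have H: "card (sign_patterns a ?H K) \<le> (if d = 0 then 0 else R_c (card K) d)"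
      proof (cases "dim ?H = 0")
        case True
        then have "?H \<subseteq> {0}"
          by (simp add: dim_eq_0)
        moreover obtain j where "j \<in> K"
          using nonempty by auto
        ultimately have "sign_patterns a ?H K = {}"
          by (intro sign_patterns_empty[of j]) auto
        then show ?thesis
          by simp
      next
        case False
        have "card (sign_patterns a ?H K) \<le> R_c (card K) (dim ?H)"
          using insert.IH subH by blast
        also have "\<dots> \<le> R_c (card K) d"
          using False d N by (auto simp: R_c_def intro!: sum_mono2)
        finally show ?thesis
          using False d by auto
      qed
      have "card (sign_patterns a S (insert k K))
          \<le> R_c (card K) (Suc d) + (if d = 0 then 0 else R_c (card K) d)"
        using card_sign_patterns_insert[OF insert.hyps insert.prems, of a] S H by linarith
      also have "\<dots> \<le> R_c (Suc (card K)) (Suc d)"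
        using N R_c_Suc_Suc[of "card K" d] R_c_mono[of "card K" "Suc (card K)" "Suc d"] by auto
      finally show ?thesis
        using insert.hyps d by simp
    qed
  qed
qed

text \<open>The hyperplanes are avoided one at a time: along the line
  \<open>e + t *\<^sub>R a k\<close> the product with \<open>a k\<close> vanishes for one
  \<open>t\<close> only, while membership in \<open>U\<close> and the earlier inequalities survive
  for small \<open>t\<close>.\<close>

lemma exists_nonorthogonal_near:
  fixes a :: "'k \<Rightarrow> 'a::real_inner"
  assumes "finite K" "subspace S" "\<And>k. k \<in> K \<Longrightarrow> a k \<in> S \<and> a k \<noteq> 0" "c \<in> S" "open U" "c \<in> U"
  shows "\<exists>e \<in> S \<inter> U. \<forall>k\<in>K. a k \<bullet> e \<noteq> 0"
  using assms(1,3)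
proof (induction K rule: finite_induct)
  case empty
  then show ?case
    using assms by auto
next
  case (insert k K)
  then obtain e where e: "e \<in> S" "e \<in> U" "\<And>j. j \<in> K \<Longrightarrow> a j \<bullet> e \<noteq> 0"
    by (metis IntE insertCI)
  let ?f = "\<lambda>t. e + t *\<^sub>R a k"
  have "(?f \<longlongrightarrow> ?f 0) (at 0)"
    by (intro tendsto_intros)
  then have lim: "(?f \<longlongrightarrow> e) (at 0)"
    by simp
  have "\<forall>\<^sub>F t in at 0. ?f t \<in> U"
    using lim assms(5) e(2) by (rule topological_tendstoD)
  moreover have "\<forall>\<^sub>F t in at 0. \<forall>j\<in>K. a j \<bullet> ?f t \<noteq> 0"
  proof (intro eventually_ball_finite insert.hyps ballI)
    fix j assume "j \<in> K"
    have "((\<lambda>t. a j \<bullet> ?f t) \<longlongrightarrow> a j \<bullet> e) (at 0)"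
      using lim by (intro tendsto_intros)
    then show "\<forall>\<^sub>F t in at 0. a j \<bullet> ?f t \<noteq> 0"
      using e(3)[OF \<open>j \<in> K\<close>] by (rule tendsto_imp_eventually_ne)
  qed
  moreover have "\<forall>\<^sub>F t in at 0. a k \<bullet> ?f t \<noteq> 0"
  proof -
    have "a k \<bullet> ?f t \<noteq> 0" if "t \<noteq> - (a k \<bullet> e) / (a k \<bullet> a k)" for t
    proof
      assume "a k \<bullet> ?f t = 0"
      then have "t * (a k \<bullet> a k) = - (a k \<bullet> e)"
        by (simp add: inner_add_right)
      then show False
        using that insert.prems[of k] by (simp add: field_simps)
    qed
    moreover have "\<forall>\<^sub>F t in at 0. t \<noteq> - (a k \<bullet> e) / (a k \<bullet> a k)"
      by (rule eventually_neq_at_within)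
    ultimately show ?thesis
      by (rule eventually_mono[rotated]) auto
  qed
  ultimately have "\<forall>\<^sub>F t in at 0. ?f t \<in> U \<and> (\<forall>j\<in>insert k K. a j \<bullet> ?f t \<noteq> 0)"
    by eventually_elim auto
  then obtain t :: real where "?f t \<in> U" "\<forall>j\<in>insert k K. a j \<bullet> ?f t \<noteq> 0"
    using eventually_happens[of _ "at (0::real)"] by auto
  moreover have "?f t \<in> S"
    using e(1) insert.prems[of k] assms(2) by (auto intro: subspace_add subspace_scale)
  ultimately show ?case
    by blast
qed

subsection \<open>Linear functionals on a regular polygon\<close>

lemma roots_of_unity_eq: "1 \<le> m \<Longrightarrow> roots_of_unity m = {z. z ^ m = 1}"
  by (simp add: roots_of_unity_def complex_roots_unity)

lemma finite_roots_of_unity: "1 \<le> m \<Longrightarrow> finite (roots_of_unity m)"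
  by (simp add: roots_of_unity_eq finite_roots_unity)

lemma card_roots_of_unity: "1 \<le> m \<Longrightarrow> card (roots_of_unity m) = m"
  by (simp add: roots_of_unity_eq card_complex_roots_unity)

lemma norm_roots_of_unity: "\<omega> \<in> roots_of_unity m \<Longrightarrow> norm \<omega> = 1"
  by (auto simp: roots_of_unity_def norm_exp_eq_Re)

lemma roots_of_unity_rotate:
  assumes "1 \<le> m" "\<omega> \<in> roots_of_unity m"
  shows "\<omega> * cis (2 * (pi / m)) \<in> roots_of_unity m"
    and "\<omega> * cis (- (2 * (pi / m))) \<in> roots_of_unity m"
proof -
  have "real m * (2 * (pi / m)) = 2 * pi"
    using assms by simp
  then have "cis (2 * (pi / m)) ^ m = cis (2 * pi)" "cis (- (2 * (pi / m))) ^ m = cis (- (2 * pi))"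
    by (metis Complex.DeMoivre mult_minus_right)+
  then have "cis (2 * (pi / m)) ^ m = 1" "cis (- (2 * (pi / m))) ^ m = 1"
    by (simp_all add: complex_eq_iff)
  then show "\<omega> * cis (2 * (pi / m)) \<in> roots_of_unity m"
    and "\<omega> * cis (- (2 * (pi / m))) \<in> roots_of_unity m"
    using assms by (auto simp: roots_of_unity_eq power_mult_distrib)
qed

text \<open>Half-angle form: \<open>1 - cos (2 * \<sigma>)\<close> and
  \<open>sin (2 * \<sigma>)\<close> share the factor \<open>2 * sin \<sigma>\<close>. Where
  \<open>sin \<sigma>\<close> is positive, comparing the two products becomes a linear inequality in
  the real and imaginary parts of \<open>cnj w * \<omega>\<close>.\<close>

lemma inner_rotate:
  "w \<bullet> (\<omega> * cis (2 * \<sigma>))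
    = w \<bullet> \<omega> - 2 * sin \<sigma> * (Re (cnj w * \<omega>) * sin \<sigma> + Im (cnj w * \<omega>) * cos \<sigma>)"
proof -
  have "w \<bullet> (\<omega> * cis (2 * \<sigma>)) = Re (cnj w * \<omega>) * cos (2 * \<sigma>) - Im (cnj w * \<omega>) * sin (2 * \<sigma>)"
    by (simp add: inner_complex_def algebra_simps)
  also have "\<dots> = Re (cnj w * \<omega>)
      - 2 * sin \<sigma> * (Re (cnj w * \<omega>) * sin \<sigma> + Im (cnj w * \<omega>) * cos \<sigma>)"
    unfolding cos_double_sin sin_double power2_eq_square by (simp only: algebra_simps)
  also have "Re (cnj w * \<omega>) = w \<bullet> \<omega>"
    by (simp add: inner_complex_def)
  finally show ?thesis
    by (simp add: inner_complex_def)
qed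

text \<open>The quotient of the roots is \<open>cis (2 * \<sigma>)\<close> with
  \<open>\<sigma> = q * (pi / m)\<close> and \<open>1 \<le> q \<le> m - 1\<close>. So
  \<open>\<sigma>\<close> lies between \<open>pi / m\<close> and \<open>pi - pi / m\<close>, where
  the sine is smallest and the absolute cosine largest at the ends.\<close>

lemma roots_of_unity_other:
  assumes "3 \<le> m" "\<omega> \<in> roots_of_unity m" "\<eta> \<in> roots_of_unity m" "\<eta> \<noteq> \<omega>"
  obtains \<sigma> where "\<eta> = \<omega> * cis (2 * \<sigma>)" "sin (pi / m) \<le> sin \<sigma>" "\<bar>cos \<sigma>\<bar> \<le> cos (pi / m)"
proof -
  have "\<omega> \<noteq> 0"
    using norm_roots_of_unity[OF assms(2)] by auto
  have "\<eta> / \<omega> \<in> roots_of_unity m"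
    using assms by (simp add: roots_of_unity_eq power_divide)
  then obtain q where q: "q < m" "\<eta> / \<omega> = exp (2 * of_real pi * \<i> * of_nat q / of_nat m)"
    by (auto simp: roots_of_unity_def)
  define \<sigma> where "\<sigma> = real q * (pi / m)"
  have eq: "\<eta> = \<omega> * cis (2 * \<sigma>)"
    using q(2) \<open>\<omega> \<noteq> 0\<close> by (simp add: cis_conv_exp \<sigma>_def field_simps)
  have "q \<noteq> 0"
    using eq assms(4) by (intro notI) (simp add: \<sigma>_def)
  have "1 * (pi / m) \<le> \<sigma>"
    unfolding \<sigma>_def using \<open>q \<noteq> 0\<close> by (intro mult_right_mono) auto
  moreover have "\<sigma> \<le> (real m - 1) * (pi / m)"
    unfolding \<sigma>_def using q(1) by (intro mult_right_mono) auto
  then have "\<sigma> \<le> pi - pi / m"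
    using assms(1) by (simp add: field_simps)
  moreover have "0 \<le> pi / m"
    by simp
  ultimately have "cos \<sigma> \<le> cos (pi / m)" "cos (pi - \<sigma>) \<le> cos (pi / m)"
    by (intro cos_monotone_0_pi_le; linarith)+
  then have c: "\<bar>cos \<sigma>\<bar> \<le> cos (pi / m)"
    by simp
  then have "(cos \<sigma>)\<^sup>2 \<le> (cos (pi / m))\<^sup>2"
    by (metis abs_le_square_iff abs_ge_zero abs_of_nonneg order_trans)
  then have "(sin (pi / m))\<^sup>2 \<le> (sin \<sigma>)\<^sup>2"
    by (simp add: cos_squared_eq)
  moreover have "0 \<le> sin \<sigma>"
    using \<open>1 * (pi / m) \<le> \<sigma>\<close> \<open>\<sigma> \<le> pi - pi / m\<close> \<open>0 \<le> pi / m\<close> by (intro sin_ge_zero) linarith+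
  ultimately have "sin (pi / m) \<le> sin \<sigma>"
    by (rule power2_le_imp_le)
  with eq c that show ?thesis
    by blast
qed

text \<open>The condition \<open>3 \<le> m\<close> puts \<open>pi / m\<close> strictly below
  \<open>pi / 2\<close>; for \<open>m = 2\<close> the cosine would vanish.\<close>

lemma sin_cos_pi_div_pos:
  assumes "3 \<le> m"
  shows "0 < sin (pi / real m)" "0 < cos (pi / real m)"
proof -
  have "0 < pi / m" "pi / m < pi / 2"
    using assms by (simp, intro divide_strict_left_mono, auto)
  moreover have "pi / 2 < pi"
    by simp
  ultimately show "0 < sin (pi / real m)" "0 < cos (pi / real m)"
    by (meson sin_gt_zero less_trans, meson cos_gt_zero)
qed

text \<open>The factor \<open>2 * sin (pi / m)\<close> in \<open>inner_rotate\<close> is positive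
  and can be cancelled. Geometrically, \<open>cnj w * \<omega>\<close> lies in the closed sector of
  half-angle \<open>pi / m\<close> around the positive real axis.\<close>

lemma neighbours_imp_cone:
  fixes m :: nat
  assumes "3 \<le> m"
    and "w \<bullet> (\<omega> * cis (2 * (pi / m))) \<le> w \<bullet> \<omega>"
    and "w \<bullet> (\<omega> * cis (- (2 * (pi / m)))) \<le> w \<bullet> \<omega>"
  shows "\<bar>Im (cnj w * \<omega>)\<bar> * cos (pi / m) \<le> Re (cnj w * \<omega>) * sin (pi / m)"
proof -
  let ?a = "Re (cnj w * \<omega>)" and ?b = "Im (cnj w * \<omega>)"
  have "0 \<le> 2 * sin (pi / m) * (?a * sin (pi / m) + ?b * cos (pi / m))"
    using assms(2) inner_rotate[of w \<omega> "pi / m"] by linarith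
  moreover have "0 \<le> 2 * sin (pi / m) * (?a * sin (pi / m) - ?b * cos (pi / m))"
    using assms(3) inner_rotate[of w \<omega> "- (pi / m)"] by (simp add: algebra_simps)
  ultimately have "0 \<le> ?a * sin (pi / m) + ?b * cos (pi / m)" "0 \<le> ?a * sin (pi / m) - ?b * cos (pi / m)"
    using sin_cos_pi_div_pos(1)[OF assms(1)] by (simp_all add: zero_le_mult_iff)
  then have "\<bar>?b * cos (pi / m)\<bar> \<le> ?a * sin (pi / m)"
    by linarith
  then show ?thesis
    using sin_cos_pi_div_pos(2)[OF assms(1)] by (simp only: abs_mult abs_of_pos)
qed

text \<open>In the sector \<open>?a\<close> is nonnegative and dominates \<open>?b\<close> at the
  angle \<open>pi / m\<close>. Any other root has at least that sine and at most that absolute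
  cosine, which keeps \<open>?a * sin \<sigma> + ?b * cos \<sigma>\<close> nonnegative.\<close>

lemma polygon_local_max_imp_max:
  assumes "3 \<le> m" "\<omega> \<in> roots_of_unity m" "\<eta> \<in> roots_of_unity m"
    and "w \<bullet> (\<omega> * cis (2 * (pi / m))) \<le> w \<bullet> \<omega>"
    and "w \<bullet> (\<omega> * cis (- (2 * (pi / m)))) \<le> w \<bullet> \<omega>"
  shows "w \<bullet> \<eta> \<le> w \<bullet> \<omega>"
proof (cases "\<eta> = \<omega>")
  case False
  then obtain \<sigma> where \<sigma>: "\<eta> = \<omega> * cis (2 * \<sigma>)" "sin (pi / m) \<le> sin \<sigma>" "\<bar>cos \<sigma>\<bar> \<le> cos (pi / m)"
    using assms by (metis roots_of_unity_other)
  let ?a = "Re (cnj w * \<omega>)" and ?b = "Im (cnj w * \<omega>)"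
  note cone = neighbours_imp_cone[OF assms(1,4,5)]
  note pos = sin_cos_pi_div_pos[OF assms(1)]
  have "0 \<le> \<bar>?b\<bar> * cos (pi / m)"
    using pos by simp
  then have "0 \<le> ?a"
    using cone pos by (meson order_trans zero_le_mult_iff not_less)
  have "\<bar>?b * cos \<sigma>\<bar> \<le> \<bar>?b\<bar> * cos (pi / m)"
    unfolding abs_mult using \<sigma>(3) by (intro mult_left_mono) auto
  also have "\<dots> \<le> ?a * sin (pi / m)"
    by (rule cone)
  also have "\<dots> \<le> ?a * sin \<sigma>"
    using \<sigma>(2) \<open>0 \<le> ?a\<close> by (rule mult_left_mono)
  finally have "0 \<le> ?a * sin \<sigma> + ?b * cos \<sigma>"
    by linarith
  moreover have "0 \<le> sin \<sigma>"
    using \<sigma>(2) pos by linarith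
  ultimately have "0 \<le> 2 * sin \<sigma> * (?a * sin \<sigma> + ?b * cos \<sigma>)"
    by simp
  then show ?thesis
    unfolding \<sigma>(1) inner_rotate by linarith
qed simp

text \<open>On the boundary of the sector \<open>u\<close> is a nonnegative multiple of
  \<open>cis (pi / m)\<close> or \<open>cis (- (pi / m))\<close>, and the \<open>m\<close>-th power
  of either is \<open>- 1\<close>.\<close>

lemma power_on_cone_boundary:
  fixes m :: nat
  assumes "3 \<le> m" "\<bar>Im u\<bar> * cos (pi / m) = Re u * sin (pi / m)"
  shows "u ^ m = - of_real (norm u ^ m)"
proof -
  note pos = sin_cos_pi_div_pos[OF assms(1)]
  define \<rho> where "\<rho> = \<bar>Im u\<bar> / sin (pi / m)"
  have im: "\<bar>Im u\<bar> = \<rho> * sin (pi / m)" and "\<rho> \<ge> 0"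
    using pos by (simp_all add: \<rho>_def)
  have re: "Re u = \<rho> * cos (pi / m)"
    using assms(2) pos by (simp add: \<rho>_def field_simps)
  have "\<exists>s::real. (s = 1 \<or> s = - 1) \<and> Im u = s * \<bar>Im u\<bar>"
    by (cases "Im u \<ge> 0") auto
  then obtain s :: real where s: "s = 1 \<or> s = - 1" "Im u = s * \<bar>Im u\<bar>"
    by blast
  have u: "u = of_real \<rho> * cis (s * (pi / m))"
    using s re im by (auto simp: complex_eq_iff)
  then have "norm u = \<rho>"
    using \<open>\<rho> \<ge> 0\<close> by (simp add: norm_mult)
  have "real m * (s * (pi / m)) = s * pi"
    using assms(1) by simp
  then have "cis (s * (pi / m)) ^ m = cis (s * pi)"
    by (metis Complex.DeMoivre)
  also have "\<dots> = - 1"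
    using s(1) by (auto simp: complex_eq_iff)
  finally have "cis (s * (pi / m)) ^ m = - 1" .
  then have "of_real \<rho> ^ m * cis (s * (pi / m)) ^ m = - of_real (\<rho> ^ m)"
    by simp
  then show ?thesis
    by (metis \<open>norm u = \<rho>\<close> power_mult_distrib u)
qed

text \<open>A tie turns the estimates behind \<open>polygon_local_max_imp_max\<close> into
  equalities, so \<open>cnj w * \<omega>\<close> lies on the boundary of the sector. Its
  \<open>m\<close>-th power is \<open>cnj (w ^ m)\<close> because \<open>\<omega> ^ m = 1\<close>,
  and the right-hand side is real.\<close>

lemma polygon_tie_power:
  assumes "3 \<le> m" "\<omega> \<in> roots_of_unity m" "\<eta> \<in> roots_of_unity m" "\<eta> \<noteq> \<omega>"
    and max: "\<And>\<xi>. \<xi> \<in> roots_of_unity m \<Longrightarrow> w \<bullet> \<xi> \<le> w \<bullet> \<omega>"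
    and tie: "w \<bullet> \<eta> = w \<bullet> \<omega>"
  shows "w ^ m = - of_real (norm w ^ m)"
proof -
  obtain \<sigma> where \<sigma>: "\<eta> = \<omega> * cis (2 * \<sigma>)" "sin (pi / m) \<le> sin \<sigma>" "\<bar>cos \<sigma>\<bar> \<le> cos (pi / m)"
    using assms by (metis roots_of_unity_other)
  define u where "u = cnj w * \<omega>"
  have cone: "\<bar>Im u\<bar> * cos (pi / m) \<le> Re u * sin (pi / m)"
    unfolding u_def using assms roots_of_unity_rotate[of m \<omega>] by (intro neighbours_imp_cone max) auto
  note pos = sin_cos_pi_div_pos[OF assms(1)]
  have "0 \<le> \<bar>Im u\<bar> * cos (pi / m)"
    using pos by simp
  then have "0 \<le> Re u"
    using cone pos by (meson order_trans zero_le_mult_iff not_less)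
  have "\<bar>Im u\<bar> * cos (pi / m) = Re u * sin (pi / m)"
  proof (rule antisym[OF cone])
    have "Re u * sin (pi / m) \<le> Re u * sin \<sigma>"
      using \<sigma>(2) \<open>0 \<le> Re u\<close> by (rule mult_left_mono)
    \<comment> \<open>By the tie the factored difference in \<open>inner_rotate\<close> is zero, and
      the positive \<open>sin \<sigma>\<close> cancels.\<close>
    also have "\<dots> = - (Im u * cos \<sigma>)"
      using tie pos \<sigma>(2) unfolding \<sigma>(1) inner_rotate u_def[symmetric] by auto
    also have "\<dots> \<le> \<bar>Im u\<bar> * \<bar>cos \<sigma>\<bar>"
      by (metis abs_ge_minus_self abs_mult)
    also have "\<dots> \<le> \<bar>Im u\<bar> * cos (pi / m)"
      using \<sigma>(3) by (intro mult_left_mono) auto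
    finally show "Re u * sin (pi / m) \<le> \<bar>Im u\<bar> * cos (pi / m)" .
  qed
  then have "u ^ m = - of_real (norm u ^ m)"
    by (rule power_on_cone_boundary[OF assms(1)])
  moreover have "norm u = norm w" "u ^ m = cnj (w ^ m)"
    using assms(1,2) norm_roots_of_unity[OF assms(2)]
    by (auto simp: u_def norm_mult power_mult_distrib roots_of_unity_eq)
  ultimately have "cnj (w ^ m) = - of_real (norm w ^ m)"
    by simp
  then have "cnj (cnj (w ^ m)) = cnj (- of_real (norm w ^ m))"
    by (rule arg_cong)
  then show ?thesis
    by simp
qed

subsection \<open>Vertices of the projected polytope\<close>

lemma lookup_scaleR [simp]:
  "Poly_Mapping.lookup (r *\<^sub>R x) i = r *\<^sub>R Poly_Mapping.lookup x i"
proof -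
  have "finite {i. r *\<^sub>R Poly_Mapping.lookup x i \<noteq> 0}"
    by (rule finite_subset[OF _ finite_lookup[of x]]) auto
  then show ?thesis
    by (simp add: scaleR_poly_mapping_def)
qed

lemma lookup_Abs_truncated [simp]:
  "Poly_Mapping.lookup (Poly_Mapping.Abs_poly_mapping (\<lambda>i. if i < (n::nat) then g i else 0)) i
    = (if i < n then g i else 0)"
proof -
  have "finite {i. (if i < n then g i else 0) \<noteq> 0}"
    by (rule finite_subset[of _ "{..<n}"]) (auto split: if_splits)
  then show ?thesis
    by simp
qed

lemma truncated_in_alphabet_power:
  "Poly_Mapping.Abs_poly_mapping (\<lambda>i. if i < n then g i else 0) \<in> alphabet_power m n
    \<longleftrightarrow> (\<forall>i<n. g i \<in> roots_of_unity m)"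
  by (auto simp: alphabet_power_def)

lemma update_in_alphabet_power:
  assumes "x \<in> alphabet_power m n" "i < n" "\<omega> \<in> roots_of_unity m"
  shows "Poly_Mapping.update i \<omega> x \<in> alphabet_power m n"
  using assms by (auto simp: alphabet_power_def lookup_update)

lemma one_in_roots_of_unity: "1 \<le> m \<Longrightarrow> 1 \<in> roots_of_unity m"
  by (simp add: roots_of_unity_eq)

lemma exists_alphabet_power:
  assumes "1 \<le> m"
  obtains x where "x \<in> alphabet_power m n"
  using truncated_in_alphabet_power[of n "\<lambda>_. 1" m] one_in_roots_of_unity[OF assms] by blast

lemma finite_alphabet_power:
  assumes "1 \<le> m"
  shows "finite (alphabet_power m n)"
proof (rule finite_subset)
  let ?vec = "\<lambda>g. Poly_Mapping.Abs_poly_mapping (\<lambda>i. if i < n then g i else 0)"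
  show "alphabet_power m n \<subseteq> ?vec ` (PiE {..<n} (\<lambda>_. roots_of_unity m))"
  proof
    fix x assume x: "x \<in> alphabet_power m n"
    have "x = ?vec (restrict (Poly_Mapping.lookup x) {..<n})"
      using x by (intro poly_mapping_eqI) (auto simp: alphabet_power_def)
    moreover have "restrict (Poly_Mapping.lookup x) {..<n} \<in> PiE {..<n} (\<lambda>_. roots_of_unity m)"
      using x by (auto simp: alphabet_power_def)
    ultimately show "x \<in> ?vec ` (PiE {..<n} (\<lambda>_. roots_of_unity m))"
      by (rule image_eqI)
  qed
qed (use finite_roots_of_unity[OF assms] in \<open>auto intro!: finite_imageI finite_PiE\<close>)

text \<open>The objective is a sum of independent terms: replacing a single coordinate of
  \<open>x\<close> isolates its term, and termwise bounds add up.\<close>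

lemma alphabet_power_maximizer_iff:
  assumes "x \<in> alphabet_power m n"
  shows "(\<forall>y \<in> alphabet_power m n.
      (\<Sum>i<n. w i \<bullet> Poly_Mapping.lookup y i) \<le> (\<Sum>i<n. w i \<bullet> Poly_Mapping.lookup x i))
    \<longleftrightarrow> (\<forall>i<n. \<forall>\<omega> \<in> roots_of_unity m. w i \<bullet> \<omega> \<le> w i \<bullet> Poly_Mapping.lookup x i)"
proof (intro iffI allI ballI impI)
  fix i \<omega>
  assume max: "\<forall>y \<in> alphabet_power m n.
      (\<Sum>i<n. w i \<bullet> Poly_Mapping.lookup y i) \<le> (\<Sum>i<n. w i \<bullet> Poly_Mapping.lookup x i)"
    and i: "i < n" and \<omega>: "\<omega> \<in> roots_of_unity m"
  let ?y = "Poly_Mapping.update i \<omega> x"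
  have rest: "(\<Sum>j\<in>{..<n} - {i}. w j \<bullet> Poly_Mapping.lookup ?y j)
      = (\<Sum>j\<in>{..<n} - {i}. w j \<bullet> Poly_Mapping.lookup x j)"
    by (intro sum.cong) (auto simp: lookup_update)
  have "(\<Sum>i<n. w i \<bullet> Poly_Mapping.lookup ?y i) \<le> (\<Sum>i<n. w i \<bullet> Poly_Mapping.lookup x i)"
    using max assms i \<omega> update_in_alphabet_power by blast
  then show "w i \<bullet> \<omega> \<le> w i \<bullet> Poly_Mapping.lookup x i"
    using i rest by (simp add: sum.remove[of "{..<n}" i] lookup_update)
next
  fix y
  assume "\<forall>i<n. \<forall>\<omega> \<in> roots_of_unity m. w i \<bullet> \<omega> \<le> w i \<bullet> Poly_Mapping.lookup x i"
    and "y \<in> alphabet_power m n"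
  then show "(\<Sum>i<n. w i \<bullet> Poly_Mapping.lookup y i) \<le> (\<Sum>i<n. w i \<bullet> Poly_Mapping.lookup x i)"
    by (intro sum_mono) (auto simp: alphabet_power_def)
qed

lemma linear_conj_transpose_mult: "linear (conj_transpose_mult n B)"
proof (rule linearI)
  show "conj_transpose_mult n B (x + y) = conj_transpose_mult n B x + conj_transpose_mult n B y"
    for x y
    by (simp add: conj_transpose_mult_def vec_eq_iff lookup_add ring_distribs sum.distrib)
  show "conj_transpose_mult n B (r *\<^sub>R x) = r *\<^sub>R conj_transpose_mult n B x" for r x
    by (simp add: conj_transpose_mult_def vec_eq_iff scaleR_sum_right)
qed

lemma projected_polytope_eq:
  "projected_polytope m n B = convex hull (conj_transpose_mult n B ` alphabet_power m n)"
  unfolding projected_polytope_def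
  by (rule convex_hull_linear_image[OF linear_conj_transpose_mult])

text \<open>Entry \<open>i\<close> of the matrix-vector product of \<open>B\<close> and
  \<open>c\<close>. By adjointness it is the weight of coordinate \<open>i\<close> when
  \<open>c\<close> is evaluated on a projected word.\<close>

definition row_weight :: "'r::finite rows \<Rightarrow> complex ^ 'r \<Rightarrow> nat \<Rightarrow> complex" where
  "row_weight B c i = (\<Sum>j\<in>UNIV. B i $ j * c $ j)"

lemma inner_conj_row:
  "c \<bullet> (\<chi> j. cnj (B i $ j) * z) = row_weight B c i \<bullet> z"
  unfolding inner_vec_def row_weight_def inner_sum_left
  by (intro sum.cong) (auto simp: inner_complex_def algebra_simps)

lemma conj_transpose_mult_eq_sum:
  "conj_transpose_mult n B x = (\<Sum>i<n. \<chi> j. cnj (B i $ j) * Poly_Mapping.lookup x i)"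
  by (simp add: conj_transpose_mult_def vec_eq_iff)

lemma inner_conj_transpose_mult:
  "c \<bullet> conj_transpose_mult n B x = (\<Sum>i<n. row_weight B c i \<bullet> Poly_Mapping.lookup x i)"
  by (simp add: conj_transpose_mult_eq_sum inner_sum_right inner_conj_row)

text \<open>Indexed by a row and the root where the edge starts, which gives \<open>m * n\<close>
  pairs for \<open>n\<close> rows. The sign of a functional on the edge tells which endpoint it
  prefers in coordinate \<open>i\<close>.\<close>

definition edge_vector :: "nat \<Rightarrow> 'r::finite rows \<Rightarrow> nat \<times> complex \<Rightarrow> complex ^ 'r" where
  "edge_vector m B = (\<lambda>(i, \<omega>). \<chi> j. cnj (B i $ j) * (\<omega> * cis (2 * (pi / m)) - \<omega>))"

lemma edge_vector_inner:
  "edge_vector m B (i, \<omega>) \<bullet> c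
    = row_weight B c i \<bullet> (\<omega> * cis (2 * (pi / m))) - row_weight B c i \<bullet> \<omega>"
  unfolding edge_vector_def prod.case by (subst inner_commute) (simp only: inner_conj_row inner_diff_right)

lemma edge_vector_inner_pred:
  "edge_vector m B (i, \<omega> * cis (- (2 * (pi / m)))) \<bullet> c
    = row_weight B c i \<bullet> \<omega> - row_weight B c i \<bullet> (\<omega> * cis (- (2 * (pi / m))))"
proof -
  have "\<omega> * cis (- (2 * (pi / m))) * cis (2 * (pi / m)) = \<omega>"
    by (simp add: mult.assoc cis_mult)
  then show ?thesis
    by (simp only: edge_vector_inner)
qed

lemma edge_vector_nonzero:
  assumes "3 \<le> m" "\<omega> \<in> roots_of_unity m" "B i \<noteq> 0"
  shows "edge_vector m B (i, \<omega>) \<noteq> 0"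
proof -
  obtain j where j: "B i $ j \<noteq> 0"
    using assms(3) by (auto simp: vec_eq_iff)
  have "0 < sin (pi / m)" "0 < cos (pi / m)"
    using sin_cos_pi_div_pos[OF assms(1)] by auto
  then have "sin (2 * (pi / m)) \<noteq> 0"
    unfolding sin_double by simp
  then have "cis (2 * (pi / m)) \<noteq> 1"
    by (metis cis.sel(2) one_complex.sel(2))
  moreover have "\<omega> \<noteq> 0"
    using norm_roots_of_unity[OF assms(2)] by auto
  ultimately show ?thesis
    using j by (auto simp: edge_vector_def vec_eq_iff)
qed

text \<open>Two words that differ only at coordinate \<open>i\<close> have the edge as difference of
  their images. This places the edge vectors in the direction space of the polytope, so that its
  dimension enters the count.\<close>

lemma edge_vector_eq_diff:
  assumes "1 \<le> m" "i < n" "\<omega> \<in> roots_of_unity m"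
  obtains x y where "x \<in> alphabet_power m n" "y \<in> alphabet_power m n"
    "edge_vector m B (i, \<omega>) = conj_transpose_mult n B y - conj_transpose_mult n B x"
proof -
  obtain x0 where x0: "x0 \<in> alphabet_power m n"
    using exists_alphabet_power[OF assms(1)] .
  define x where "x = Poly_Mapping.update i \<omega> x0"
  define y where "y = Poly_Mapping.update i (\<omega> * cis (2 * (pi / m))) x0"
  have "x \<in> alphabet_power m n" "y \<in> alphabet_power m n"
    using x0 assms roots_of_unity_rotate by (auto simp: x_def y_def intro!: update_in_alphabet_power)
  moreover have "edge_vector m B (i, \<omega>) = conj_transpose_mult n B y - conj_transpose_mult n B x"
  proof -
    have "(\<Sum>l\<in>{..<n} - {i}. cnj (B l $ j) * Poly_Mapping.lookup y l)
        = (\<Sum>l\<in>{..<n} - {i}. cnj (B l $ j) * Poly_Mapping.lookup x l)" for j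
      by (intro sum.cong) (auto simp: x_def y_def lookup_update)
    then show ?thesis
      using assms(2)
      by (simp add: vec_eq_iff edge_vector_def conj_transpose_mult_def
          sum.remove[of "{..<n}" i] x_def y_def lookup_update right_diff_distrib)
  qed
  ultimately show ?thesis
    using that by blast
qed

text \<open>Every face of a polyhedron is exposed, in particular \<open>{v}\<close>; so some
  supporting hyperplane meets the hull in \<open>v\<close> alone.\<close>

lemma vertex_unique_maximizer:
  fixes F :: "'a::euclidean_space set"
  assumes "finite F" "v extreme_point_of (convex hull F)"
  shows "\<exists>c. \<forall>y\<in>F. y \<noteq> v \<longrightarrow> c \<bullet> y < c \<bullet> v"
proof -
  have "polyhedron (convex hull F)"
    using assms(1) by (simp add: polyhedron_convex_hull)
  moreover have "{v} face_of (convex hull F)"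
    using assms(2) by (simp add: face_of_singleton)
  ultimately have "{v} exposed_face_of (convex hull F)"
    by (simp add: exposed_face_of_polyhedron)
  then obtain c b where c: "convex hull F \<subseteq> {x. c \<bullet> x \<le> b}"
    "{v} = (convex hull F) \<inter> {x. c \<bullet> x = b}"
    by (auto simp: exposed_face_of_def)
  have "c \<bullet> y < c \<bullet> v" if "y \<in> F" "y \<noteq> v" for y
  proof -
    have "y \<in> convex hull F"
      using that by (simp add: hull_inc)
    moreover have "c \<bullet> v = b"
      using c(2) by blast
    moreover have "c \<bullet> y \<noteq> b"
      using c(2) that \<open>y \<in> convex hull F\<close> by blast
    ultimately show ?thesis
      using c(1) by fastforce
  qed
  then show ?thesis
    by blast
qed

text \<open>The differences of points of \<open>F\<close> lie in \<open>W\<close>, so projecting an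
  exposing functional to \<open>W\<close> does not change its values on them. As \<open>F\<close> is
  finite, strict maximality at \<open>v\<close> is an open condition, which leaves room to move off
  all hyperplanes within \<open>W\<close>.\<close>

lemma vertex_generic_maximizer:
  fixes F W :: "'a::euclidean_space set" and a :: "'k \<Rightarrow> 'a"
  assumes "finite F" "v extreme_point_of (convex hull F)" "subspace W"
    and diff: "\<And>x y. x \<in> F \<Longrightarrow> y \<in> F \<Longrightarrow> x - y \<in> W"
    and K: "finite K" "\<And>k. k \<in> K \<Longrightarrow> a k \<in> W \<and> a k \<noteq> 0"
  shows "\<exists>c\<in>W. (\<forall>k\<in>K. a k \<bullet> c \<noteq> 0) \<and> (\<forall>y\<in>F. y \<noteq> v \<longrightarrow> c \<bullet> y < c \<bullet> v)"
proof -
  have "v \<in> F"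
    using assms(2) by (rule extreme_point_of_convex_hull)
  obtain c where c: "\<And>y. y \<in> F \<Longrightarrow> y \<noteq> v \<Longrightarrow> c \<bullet> y < c \<bullet> v"
    using vertex_unique_maximizer[OF assms(1,2)] by blast
  obtain p q where pq: "p \<in> span W" "\<And>w. w \<in> span W \<Longrightarrow> orthogonal q w" "c = p + q"
    using orthogonal_subspace_decomp_exists[of W c] by blast
  define U where "U = (\<Inter>y\<in>F - {v}. {e. (y - v) \<bullet> e < 0})"
  have "open U"
    unfolding U_def using assms(1) by (intro open_INT ballI open_halfspace_lt) auto
  moreover have "p \<in> U"
    unfolding U_def
  proof (intro INT_I CollectI)
    fix y assume "y \<in> F - {v}"
    then have y: "y \<in> F" "y \<noteq> v"
      by auto
    have "orthogonal q (y - v)"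
      using diff[OF y(1) \<open>v \<in> F\<close>] by (intro pq(2) span_base)
    then show "(y - v) \<bullet> p < 0"
      using c[OF y] unfolding pq(3)
      by (simp add: orthogonal_def inner_diff_left inner_diff_right inner_add_left inner_add_right
          inner_commute)
  qed
  moreover have "p \<in> W"
    using pq(1) assms(3) by (simp add: span_eq_iff[THEN iffD2])
  ultimately obtain e where e: "e \<in> W" "e \<in> U" "\<forall>k\<in>K. a k \<bullet> e \<noteq> 0"
    using exists_nonorthogonal_near[where a = a and c = p and U = U, OF K(1) assms(3) K(2)] by auto
  have "e \<bullet> y < e \<bullet> v" if "y \<in> F" "y \<noteq> v" for y
  proof -
    have "(y - v) \<bullet> e < 0"
      using e(2) that by (auto simp: U_def)
    then show ?thesis
      by (simp add: inner_diff_right inner_commute)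
  qed
  with e(1,3) show ?thesis
    by blast
qed

text \<open>In each coordinate, maximality for \<open>c\<close> fixes the signs on the two edges at
  the root chosen by \<open>x\<close>. Equal signs make that root a local maximum for
  \<open>e\<close>, and a local maximum on the polygon is global. Zero rows have weight
  zero.\<close>

lemma same_signs_imp_maximizer:
  assumes "3 \<le> m" "x \<in> alphabet_power m n"
    and generic: "\<And>i \<omega>. i < n \<Longrightarrow> \<omega> \<in> roots_of_unity m \<Longrightarrow> B i \<noteq> 0 \<Longrightarrow> edge_vector m B (i, \<omega>) \<bullet> c \<noteq> 0"
    and max: "\<forall>y \<in> alphabet_power m n. c \<bullet> conj_transpose_mult n B y \<le> c \<bullet> conj_transpose_mult n B x"
    and same: "\<And>i \<omega>. i < n \<Longrightarrow> \<omega> \<in> roots_of_unity m \<Longrightarrow> B i \<noteq> 0 \<Longrightarrow>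
      0 < edge_vector m B (i, \<omega>) \<bullet> c \<longleftrightarrow> 0 < edge_vector m B (i, \<omega>) \<bullet> e"
  shows "\<forall>y \<in> alphabet_power m n. e \<bullet> conj_transpose_mult n B y \<le> e \<bullet> conj_transpose_mult n B x"
  unfolding inner_conj_transpose_mult alphabet_power_maximizer_iff[OF assms(2)]
proof (intro allI impI ballI)
  fix i \<eta> assume i: "i < n" and \<eta>: "\<eta> \<in> roots_of_unity m"
  define \<omega> where "\<omega> = Poly_Mapping.lookup x i"
  have \<omega>: "\<omega> \<in> roots_of_unity m"
    using assms(2) i by (simp add: \<omega>_def alphabet_power_def)
  have rot: "\<omega> * cis (2 * (pi / m)) \<in> roots_of_unity m" "\<omega> * cis (- (2 * (pi / m))) \<in> roots_of_unity m"
    using roots_of_unity_rotate[OF _ \<omega>] assms(1) by auto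
  have coord: "row_weight B c i \<bullet> \<xi> \<le> row_weight B c i \<bullet> \<omega>" if "\<xi> \<in> roots_of_unity m" for \<xi>
    using max i that unfolding inner_conj_transpose_mult alphabet_power_maximizer_iff[OF assms(2)] \<omega>_def
    by blast
  have "row_weight B e i \<bullet> \<eta> \<le> row_weight B e i \<bullet> \<omega>"
  proof (cases "B i = 0")
    case True
    then show ?thesis
      by (simp add: row_weight_def)
  next
    case False
    have "\<not> 0 < edge_vector m B (i, \<omega>) \<bullet> c"
      using coord[OF rot(1)] by (simp add: edge_vector_inner)
    then have "\<not> 0 < edge_vector m B (i, \<omega>) \<bullet> e"
      using same[OF i \<omega> False] by simp
    then have succ: "row_weight B e i \<bullet> (\<omega> * cis (2 * (pi / m))) \<le> row_weight B e i \<bullet> \<omega>"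
      unfolding edge_vector_inner by linarith
    \<comment> \<open>Maximality gives only a nonnegative product on the incoming edge;
      \<open>generic\<close> makes it positive, so that its sign transfers to
      \<open>e\<close>.\<close>
    have "0 < edge_vector m B (i, \<omega> * cis (- (2 * (pi / m)))) \<bullet> c"
      using coord[OF rot(2)] generic[OF i rot(2) False] unfolding edge_vector_inner_pred by linarith
    then have "0 < edge_vector m B (i, \<omega> * cis (- (2 * (pi / m)))) \<bullet> e"
      by (rule same[OF i rot(2) False, THEN iffD1])
    then have "row_weight B e i \<bullet> (\<omega> * cis (- (2 * (pi / m)))) \<le> row_weight B e i \<bullet> \<omega>"
      unfolding edge_vector_inner_pred by linarith
    with succ show ?thesis
      by (rule polygon_local_max_imp_max[OF assms(1) \<omega> \<eta>])
  qed
  then show "row_weight B e i \<bullet> \<eta> \<le> row_weight B e i \<bullet> Poly_Mapping.lookup x i"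
    by (simp add: \<omega>_def)
qed

text \<open>Each vertex \<open>v\<close> gets a generic functional \<open>c v\<close> whose only
  maximizer is \<open>v\<close>. If \<open>c v\<close> and \<open>c u\<close> have the same sign
  pattern, then \<open>v\<close> also maximizes \<open>c u\<close>, so \<open>v = u\<close>. Hence
  the vertices inject into the sign patterns.\<close>

lemma card_vertices_le:
  fixes m n :: nat and B :: "'r::finite rows"
  assumes "3 \<le> m"
  defines "P \<equiv> projected_polytope m n B"
  shows "finite (vertices P)" "card (vertices P) \<le> R_c (m * n) (real_dim P)"
proof -
  define f where "f = conj_transpose_mult n B"
  define F where "F = f ` alphabet_power m n"
  have m: "1 \<le> m"
    using assms by simp
  have P: "P = convex hull F"
    by (simp add: P_def F_def f_def projected_polytope_eq)
  have finF: "finite F"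
    using finite_alphabet_power[OF m] by (simp add: F_def)
  have vF: "vertices P \<subseteq> F"
    unfolding P vertices_def using extreme_point_of_convex_hull by auto
  then show "finite (vertices P)"
    using finF by (rule finite_subset)
  obtain x0 where x0: "x0 \<in> alphabet_power m n"
    using exists_alphabet_power[OF m] .
  then have p0: "f x0 \<in> P"
    unfolding P F_def by (simp add: hull_inc)
  \<comment> \<open>The direction space of \<open>P\<close>: after translation by a point of
    \<open>P\<close>, the affine dimension becomes a linear one.\<close>
  define W where "W = span ((\<lambda>p. p - f x0) ` P)"
  have W: "subspace W"
    by (simp add: W_def)
  have dimW: "dim W = real_dim P"
    using aff_dim_eq_dim_subtract[of "f x0" P] p0 by (simp add: W_def real_dim_def hull_inc dim_span)
  have diff: "x - y \<in> W" if "x \<in> F" "y \<in> F" for x y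
  proof -
    have "x - f x0 \<in> W" "y - f x0 \<in> W"
      unfolding W_def using that by (auto intro!: span_base imageI simp: P hull_inc)
    then have "(x - f x0) - (y - f x0) \<in> W"
      using W by (metis subspace_diff)
    then show ?thesis
      by simp
  qed
  \<comment> \<open>A zero row has zero edge vectors, to which every functional is orthogonal, so
    only nonzero rows are indexed.\<close>
  define K where "K = {i. i < n \<and> B i \<noteq> 0} \<times> roots_of_unity m"
  have finK: "finite K"
    using finite_roots_of_unity[OF m] by (auto simp: K_def)
  have "card {i. i < n \<and> B i \<noteq> 0} \<le> card {..<n}"
    by (intro card_mono) auto
  then have cardK: "card K \<le> m * n"
    using card_roots_of_unity[OF m] by (simp add: K_def card_cartesian_product)
  have edge: "edge_vector m B k \<in> W \<and> edge_vector m B k \<noteq> 0" if kK: "k \<in> K" for k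
  proof -
    obtain i \<omega> where k: "k = (i, \<omega>)" "i < n" "B i \<noteq> 0" "\<omega> \<in> roots_of_unity m"
      using kK by (auto simp: K_def)
    obtain x y where "x \<in> alphabet_power m n" "y \<in> alphabet_power m n"
      "edge_vector m B (i, \<omega>) = f y - f x"
      using edge_vector_eq_diff[OF m k(2,4)] unfolding f_def .
    then have "edge_vector m B k \<in> W"
      unfolding k(1) by (auto intro: diff simp: F_def)
    moreover have "edge_vector m B k \<noteq> 0"
      unfolding k(1) using edge_vector_nonzero assms(1) k by blast
    ultimately show ?thesis
      by simp
  qed
  have "\<exists>c\<in>W. (\<forall>k\<in>K. edge_vector m B k \<bullet> c \<noteq> 0) \<and> (\<forall>y\<in>F. y \<noteq> v \<longrightarrow> c \<bullet> y < c \<bullet> v)"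
    if "v \<in> vertices P" for v
    using that finF W diff finK edge unfolding vertices_def P
    by (intro vertex_generic_maximizer) auto
  then obtain c where cW: "\<And>v. v \<in> vertices P \<Longrightarrow> c v \<in> W"
    and cK: "\<And>v k. v \<in> vertices P \<Longrightarrow> k \<in> K \<Longrightarrow> edge_vector m B k \<bullet> c v \<noteq> 0"
    and cmax: "\<And>v y. v \<in> vertices P \<Longrightarrow> y \<in> F \<Longrightarrow> y \<noteq> v \<Longrightarrow> c v \<bullet> y < c v \<bullet> v"
    by metis
  define pat where "pat = (\<lambda>v. {k \<in> K. 0 < edge_vector m B k \<bullet> c v})"
  have "inj_on pat (vertices P)"
  proof (rule inj_onI, rule ccontr)
    fix v u assume vu: "v \<in> vertices P" "u \<in> vertices P" "pat v = pat u" "v \<noteq> u"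
    obtain x where x: "x \<in> alphabet_power m n" "v = f x"
      using vF vu(1) by (auto simp: F_def)
    obtain y where y: "y \<in> alphabet_power m n" "u = f y"
      using vF vu(2) by (auto simp: F_def)
    have le: "c v \<bullet> f z \<le> c v \<bullet> f x" if "z \<in> alphabet_power m n" for z
      using cmax[OF vu(1), of "f z"] that x by (cases "f z = v") (auto simp: F_def)
    have same: "0 < edge_vector m B k \<bullet> c v \<longleftrightarrow> 0 < edge_vector m B k \<bullet> c u" if "k \<in> K" for k
      using vu(3) that unfolding pat_def by blast
    have "\<forall>z \<in> alphabet_power m n. c u \<bullet> f z \<le> c u \<bullet> f x"
      unfolding f_def
    proof (rule same_signs_imp_maximizer[OF assms(1) x(1)])
      show "edge_vector m B (i, \<omega>) \<bullet> c v \<noteq> 0"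
        if "i < n" "\<omega> \<in> roots_of_unity m" "B i \<noteq> 0" for i \<omega>
        using that by (intro cK[OF vu(1)]) (simp add: K_def)
      show "0 < edge_vector m B (i, \<omega>) \<bullet> c v \<longleftrightarrow> 0 < edge_vector m B (i, \<omega>) \<bullet> c u"
        if "i < n" "\<omega> \<in> roots_of_unity m" "B i \<noteq> 0" for i \<omega>
        using that by (intro same) (simp add: K_def)
      show "\<forall>z \<in> alphabet_power m n.
          c v \<bullet> conj_transpose_mult n B z \<le> c v \<bullet> conj_transpose_mult n B x"
        using le unfolding f_def by blast
    qed
    moreover have "c u \<bullet> v < c u \<bullet> u"
      using vF vu by (intro cmax) auto
    ultimately show False
      using x y by force
  qed
  moreover have "pat ` vertices P \<subseteq> sign_patterns (edge_vector m B) W K"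
    unfolding pat_def sign_patterns_def using cW cK by blast
  ultimately have "card (vertices P) \<le> card (sign_patterns (edge_vector m B) W K)"
    using finite_sign_patterns[OF finK] by (metis card_inj_on_le)
  also have "\<dots> \<le> R_c (card K) (dim W)"
    using finK W by (rule card_sign_patterns_le)
  also have "\<dots> \<le> R_c (m * n) (real_dim P)"
    unfolding dimW using cardK by (rule R_c_mono)
  finally show "card (vertices P) \<le> R_c (m * n) (real_dim P)" .
qed

section \<open>Asymptotic estimates for \<open>R_c\<close>\<close>

lemma R_c_bigo: "(\<lambda>N. real (R_c N d)) \<in> O(\<lambda>N. real N ^ (d - 1))"
proof (rule bigoI)
  show "\<forall>\<^sub>F N in at_top. norm (real (R_c N d)) \<le> 2 * real (Suc d) * norm (real N ^ (d - 1))"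
    using eventually_ge_at_top[of 1] by eventually_elim (use R_c_le_power in simp)
qed

lemma real_dim_le_DIM: "real_dim (S :: 'a::euclidean_space set) \<le> DIM('a)"
  using aff_dim_le_DIM[of S] by (simp add: real_dim_def)

text \<open>The dimension \<open>d\<close> varies with \<open>B\<close>; passing to the upper bound
  \<open>D\<close> yields a constant free of \<open>B\<close> and \<open>n\<close>. Powers grow with
  the exponent because \<open>m * n\<close> is at least \<open>1\<close>.\<close>

lemma R_c_le_power_uniform:
  assumes "1 \<le> m" "1 \<le> n" "d \<le> D"
  shows "real (R_c (m * n) d) \<le> 2 * real (Suc D) * real m ^ (D - 1) * real n ^ (D - 1)"
proof -
  have "real (R_c (m * n) d) \<le> 2 * real (Suc d) * real (m * n) ^ (d - 1)"
    using assms by (intro R_c_le_power) simp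
  also have "\<dots> \<le> 2 * real (Suc D) * real (m * n) ^ (D - 1)"
  proof -
    have "1 \<le> m * n"
      using assms by simp
    then have "real (m * n) ^ (d - 1) \<le> real (m * n) ^ (D - 1)"
      using assms(3) by (intro power_increasing) linarith+
    then show ?thesis
      using assms(3) by (intro mult_mono) auto
  qed
  finally show ?thesis
    by (simp add: power_mult_distrib mult.assoc)
qed

subsection \<open>The rank-one sweep\<close>

lemma inj_on_cis: "inj_on cis {0..<2 * pi}"
proof (rule inj_onI)
  fix x y assume xy: "x \<in> {0..<2 * pi}" "y \<in> {0..<2 * pi}" "cis x = cis y"
  then have "sin x = sin y \<and> cos x = cos y"
    by (simp add: complex_eq_iff)
  then obtain k :: int where k: "x = y + 2 * pi * k"
    using sin_cos_eq_iff by blast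
  have "2 * pi * \<bar>real_of_int k\<bar> = \<bar>x - y\<bar>"
    by (simp add: k abs_mult)
  also have "\<dots> < 2 * pi * 1"
    using xy by auto
  finally have "\<bar>real_of_int k\<bar> < 1"
    by (simp only: mult_less_cancel_left_pos[OF mult_pos_pos[OF _ pi_gt_zero]] zero_less_numeral)
  then show "x = y"
    using k by simp
qed

text \<open>The equation of \<open>polygon_tie_power\<close> for
  \<open>w = cis \<theta> * b\<close>, whose norm is \<open>norm b\<close>. For nonzero
  \<open>b\<close> and positive \<open>m\<close> it says that \<open>w\<close> points midway between
  two consecutive roots.\<close>

definition tie_angles :: "nat \<Rightarrow> complex \<Rightarrow> real set" where
  "tie_angles m b = {\<theta> \<in> {0..<2 * pi}. (cis \<theta> * b) ^ m = - of_real (norm b ^ m)}"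

text \<open>Division by \<open>b ^ m\<close> makes each \<open>cis \<theta>\<close> an
  \<open>m\<close>-th root of one fixed nonzero number, and \<open>cis\<close> is injective on
  \<open>{0..<2 * pi}\<close>.\<close>

lemma tie_angles_bound:
  assumes "1 \<le> m" "b \<noteq> 0"
  shows "finite (tie_angles m b)" "card (tie_angles m b) \<le> m"
proof -
  define c where "c = - of_real (norm b ^ m) / b ^ m"
  have "c \<noteq> 0"
    using assms(2) by (simp add: c_def)
  then have c: "finite {z. z ^ m = c}" "card {z. z ^ m = c} = m"
    using assms(1) by (simp_all add: finite_nth_roots card_nth_roots)
  have sub: "cis ` tie_angles m b \<subseteq> {z. z ^ m = c}"
    using assms(2) by (auto simp: tie_angles_def c_def power_mult_distrib field_simps)
  have inj: "inj_on cis (tie_angles m b)"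
    using inj_on_cis by (rule inj_on_subset) (auto simp: tie_angles_def)
  show "finite (tie_angles m b)"
    using inj sub c(1) by (metis finite_imageD finite_subset)
  show "card (tie_angles m b) \<le> m"
    using inj sub c by (metis card_inj_on_le)
qed

text \<open>Coordinates of weight zero are left free: there all roots tie for every
  \<open>z\<close>.\<close>

definition strict_choice :: "nat \<Rightarrow> nat \<Rightarrow> (nat \<Rightarrow> complex) \<Rightarrow> (nat \<Rightarrow> complex) \<Rightarrow> complex \<Rightarrow> bool" where
  "strict_choice m n b \<omega> z \<longleftrightarrow> (\<forall>i<n. b i \<noteq> 0 \<longrightarrow> \<omega> i \<in> roots_of_unity m \<and>
     (\<forall>\<xi> \<in> roots_of_unity m. \<xi> \<noteq> \<omega> i \<longrightarrow> (z * b i) \<bullet> \<xi> < (z * b i) \<bullet> \<omega> i))"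

lemma strict_choice_maximizer_unique:
  assumes "strict_choice m n b \<omega> z" "i < n" "b i \<noteq> 0" "\<eta> \<in> roots_of_unity m"
  shows "(\<forall>\<xi> \<in> roots_of_unity m. (z * b i) \<bullet> \<xi> \<le> (z * b i) \<bullet> \<eta>) \<longleftrightarrow> \<eta> = \<omega> i"
  using assms unfolding strict_choice_def by (metis less_le not_less order_refl)

text \<open>Away from the tie angles, \<open>polygon_tie_power\<close> makes the best root of each
  coordinate of nonzero weight unique. Finitely many strict inequalities, continuous in the angle,
  persist nearby, so one \<open>\<omega>\<close> serves a whole neighbourhood.\<close>

lemma strict_choice_near:
  assumes "3 \<le> m" "\<theta> \<in> {0..<2 * pi}" "\<theta> \<notin> (\<Union>i\<in>{i. i < n \<and> b i \<noteq> 0}. tie_angles m (b i))"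
  obtains \<omega> where "\<forall>\<^sub>F \<phi> in nhds \<theta>. strict_choice m n b \<omega> (cis \<phi>)"
proof -
  have fin: "finite (roots_of_unity m)" "roots_of_unity m \<noteq> {}"
    using assms(1) finite_roots_of_unity[of m] one_in_roots_of_unity[of m] by auto
  have "\<exists>\<omega>. \<omega> \<in> roots_of_unity m \<and>
      (\<forall>\<xi>\<in>roots_of_unity m. \<xi> \<noteq> \<omega> \<longrightarrow> (cis \<theta> * b i) \<bullet> \<xi> < (cis \<theta> * b i) \<bullet> \<omega>)"
    if i: "i < n" "b i \<noteq> 0" for i
  proof -
    let ?w = "cis \<theta> * b i"
    have "Max ((\<bullet>) ?w ` roots_of_unity m) \<in> (\<bullet>) ?w ` roots_of_unity m"
      using fin by (intro Max_in) auto
    then obtain \<omega> where \<omega>: "\<omega> \<in> roots_of_unity m" "Max ((\<bullet>) ?w ` roots_of_unity m) = ?w \<bullet> \<omega>"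
      by (elim imageE)
    have max: "?w \<bullet> \<xi> \<le> ?w \<bullet> \<omega>" if "\<xi> \<in> roots_of_unity m" for \<xi>
      unfolding \<omega>(2)[symmetric] using fin that by (intro Max_ge) auto
    have "?w \<bullet> \<xi> \<noteq> ?w \<bullet> \<omega>" if "\<xi> \<in> roots_of_unity m" "\<xi> \<noteq> \<omega>" for \<xi>
    proof
      assume tie: "?w \<bullet> \<xi> = ?w \<bullet> \<omega>"
      have "?w ^ m = - of_real (norm ?w ^ m)"
        using max tie by (rule polygon_tie_power[OF assms(1) \<omega>(1) that])
      then have "\<theta> \<in> tie_angles m (b i)"
        using assms(2) by (simp add: tie_angles_def norm_mult)
      then show False
        using assms(3) i by blast
    qed
    with \<omega>(1) max show ?thesis
      by (auto simp: less_le)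
  qed
  then obtain \<omega> where \<omega>: "\<And>i. i < n \<Longrightarrow> b i \<noteq> 0 \<Longrightarrow> \<omega> i \<in> roots_of_unity m"
    "\<And>i \<xi>. i < n \<Longrightarrow> b i \<noteq> 0 \<Longrightarrow> \<xi> \<in> roots_of_unity m \<Longrightarrow> \<xi> \<noteq> \<omega> i
      \<Longrightarrow> (cis \<theta> * b i) \<bullet> \<xi> < (cis \<theta> * b i) \<bullet> \<omega> i"
    by metis
  have "\<forall>\<^sub>F \<phi> in nhds \<theta>. \<forall>i\<in>{i. i < n \<and> b i \<noteq> 0}. \<forall>\<xi>\<in>roots_of_unity m - {\<omega> i}.
      (cis \<phi> * b i) \<bullet> \<xi> < (cis \<phi> * b i) \<bullet> \<omega> i"
  proof (intro eventually_ball_finite ballI)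
    fix i \<xi> assume "i \<in> {i. i < n \<and> b i \<noteq> 0}" "\<xi> \<in> roots_of_unity m - {\<omega> i}"
    then have "\<theta> \<in> {\<phi>. (cis \<phi> * b i) \<bullet> \<xi> < (cis \<phi> * b i) \<bullet> \<omega> i}"
      using \<omega> by simp
    moreover have "open {\<phi>. (cis \<phi> * b i) \<bullet> \<xi> < (cis \<phi> * b i) \<bullet> \<omega> i}"
      by (intro open_Collect_less continuous_intros)
    ultimately show "\<forall>\<^sub>F \<phi> in nhds \<theta>. (cis \<phi> * b i) \<bullet> \<xi> < (cis \<phi> * b i) \<bullet> \<omega> i"
      by (auto simp: eventually_nhds)
  qed (use fin in auto)
  then have "\<forall>\<^sub>F \<phi> in nhds \<theta>. strict_choice m n b \<omega> (cis \<phi>)"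
    by eventually_elim (use \<omega>(1) in \<open>auto simp: strict_choice_def\<close>)
  then show ?thesis
    using that by blast
qed

text \<open>Around an angle without ties one strict choice persists, and \<open>det\<close> carries
  its constancy over to \<open>f\<close>. So the events lie in at most \<open>n\<close> sets of at
  most \<open>m\<close> tie angles. Keeping \<open>f\<close> abstract serves both
  \<open>linear_maximizers\<close> and \<open>quantized_solution\<close>.\<close>

lemma phase_events_bound:
  assumes "3 \<le> m"
    and det: "\<And>\<omega> z z'. strict_choice m n b \<omega> z \<Longrightarrow> strict_choice m n b \<omega> z' \<Longrightarrow> f z = f z'"
  shows "finite (phase_events f)" "card (phase_events f) \<le> m * n"
proof -
  define I where "I = {i. i < n \<and> b i \<noteq> 0}"
  have "I \<subseteq> {..<n}"
    by (auto simp: I_def)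
  then have finI: "finite I" and "card I \<le> card {..<n}"
    by (rule finite_subset, simp, intro card_mono, simp_all)
  have sub: "phase_events f \<subseteq> (\<Union>i\<in>I. tie_angles m (b i))"
  proof (rule subsetI, rule ccontr)
    fix \<theta> assume \<theta>: "\<theta> \<in> phase_events f" "\<theta> \<notin> (\<Union>i\<in>I. tie_angles m (b i))"
    then obtain \<omega> where ev: "\<forall>\<^sub>F \<phi> in nhds \<theta>. strict_choice m n b \<omega> (cis \<phi>)"
      using strict_choice_near[where \<theta> = \<theta> and n = n and b = b, OF assms(1)] by (auto simp: phase_events_def I_def)
    then have "strict_choice m n b \<omega> (cis \<theta>)"
      by (rule eventually_nhds_x_imp_x)
    with ev have "\<forall>\<^sub>F \<phi> in nhds \<theta>. f (cis \<phi>) = f (cis \<theta>)"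
      by (elim eventually_mono) (rule det)
    then show False
      using \<theta>(1) by (simp add: phase_events_def)
  qed
  have tie: "finite (tie_angles m (b i))" "card (tie_angles m (b i)) \<le> m" if "i \<in> I" for i
    using tie_angles_bound[of m "b i"] assms(1) that by (auto simp: I_def)
  have fin: "finite (\<Union>i\<in>I. tie_angles m (b i))"
    using finI tie by blast
  then show "finite (phase_events f)"
    using sub by (rule finite_subset[rotated])
  have "card (phase_events f) \<le> card (\<Union>i\<in>I. tie_angles m (b i))"
    using fin sub by (rule card_mono)
  also have "\<dots> \<le> (\<Sum>i\<in>I. card (tie_angles m (b i)))"
    using finI by (rule card_UN_le)
  also have "\<dots> \<le> card I * m"
    using sum_bounded_above[of I "\<lambda>i. card (tie_angles m (b i))" m] tie by simp
  also have "\<dots> \<le> n * m"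
    using \<open>card I \<le> card {..<n}\<close> by (intro mult_right_mono) auto
  finally show "card (phase_events f) \<le> m * n"
    by (simp add: mult.commute)
qed

lemma linear_maximizers_iff:
  "x \<in> linear_maximizers m n B z \<longleftrightarrow> x \<in> alphabet_power m n \<and>
    (\<forall>i<n. \<forall>\<omega> \<in> roots_of_unity m. (z * B i $ 1) \<bullet> \<omega> \<le> (z * B i $ 1) \<bullet> Poly_Mapping.lookup x i)"
proof -
  have "Re (cnj z * conj_transpose_mult n B y $ 1)
      = (\<Sum>i<n. (z * B i $ 1) \<bullet> Poly_Mapping.lookup y i)" for y
    unfolding conj_transpose_mult_def vec_lambda_beta sum_distrib_left Re_sum
    by (intro sum.cong) (auto simp: inner_complex_def algebra_simps)
  then show ?thesis
    unfolding linear_maximizers_def mem_Collect_eq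
    using alphabet_power_maximizer_iff[of x m n "\<lambda>i. z * B i $ 1"] by auto
qed

text \<open>Nonzero weights force their coordinates and zero weights leave them free. No
  \<open>z\<close> occurs on the right-hand side, which is what \<open>det\<close> in
  \<open>phase_events_bound\<close> asks for.\<close>

lemma linear_maximizers_strict_choice:
  assumes "strict_choice m n (\<lambda>i. B i $ 1) \<omega> z"
  shows "linear_maximizers m n B z
    = {x \<in> alphabet_power m n. \<forall>i<n. B i $ 1 \<noteq> 0 \<longrightarrow> Poly_Mapping.lookup x i = \<omega> i}"
proof -
  have "(\<forall>\<xi> \<in> roots_of_unity m. (z * B i $ 1) \<bullet> \<xi> \<le> (z * B i $ 1) \<bullet> Poly_Mapping.lookup x i)
      \<longleftrightarrow> (B i $ 1 \<noteq> 0 \<longrightarrow> Poly_Mapping.lookup x i = \<omega> i)"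
    if "x \<in> alphabet_power m n" "i < n" for x i
  proof (cases "B i $ 1 = 0")
    case False
    then show ?thesis
      using strict_choice_maximizer_unique[OF assms that(2)] that by (simp add: alphabet_power_def)
  qed simp
  then show ?thesis
    by (auto simp: linear_maximizers_iff)
qed

text \<open>For nonzero \<open>w\<close>, the product with a root is \<open>norm w\<close> times the
  cosine of their angular distance, and the cosine decreases on \<open>[0, pi]\<close>.\<close>

lemma phase_quantizer_maximizes:
  assumes "phase_quantizer m Q" "\<xi> \<in> roots_of_unity m"
  shows "w \<bullet> \<xi> \<le> w \<bullet> Q w"
proof (cases "w = 0")
  case False
  have Q: "Q w \<in> roots_of_unity m" "\<bar>Arg (w * cnj (Q w))\<bar> \<le> \<bar>Arg (w * cnj \<xi>)\<bar>"
    using assms by (auto simp: phase_quantizer_def)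
  have inner: "w \<bullet> \<eta> = norm w * cos \<bar>Arg (w * cnj \<eta>)\<bar>" if "\<eta> \<in> roots_of_unity m" for \<eta>
  proof -
    have "norm \<eta> = 1"
      using that by (rule norm_roots_of_unity)
    then have "w * cnj \<eta> \<noteq> 0" "norm (w * cnj \<eta>) = norm w"
      using False by (auto simp: norm_mult)
    then have "cos \<bar>Arg (w * cnj \<eta>)\<bar> = Re (w * cnj \<eta>) / norm w"
      by (metis cos_abs_real cos_Arg)
    then show ?thesis
      using False by (simp add: inner_complex_def)
  qed
  have "\<bar>Arg (w * cnj \<xi>)\<bar> \<le> pi"
    using Arg_bounded[of "w * cnj \<xi>"] by linarith
  then have "cos \<bar>Arg (w * cnj \<xi>)\<bar> \<le> cos \<bar>Arg (w * cnj (Q w))\<bar>"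
    using Q(2) by (intro cos_monotone_0_pi_le) auto
  then show ?thesis
    unfolding inner[OF Q(1)] inner[OF assms(2)] by (intro mult_left_mono) auto
qed simp

lemma quantized_solution_maximizes:
  assumes "phase_quantizer m Q"
  shows "quantized_solution Q n B z \<in> linear_maximizers m n B z"
  using assms phase_quantizer_maximizes[OF assms]
  by (auto simp: linear_maximizers_iff quantized_solution_def truncated_in_alphabet_power
      phase_quantizer_def)

text \<open>At a zero entry \<open>Q\<close> is always evaluated at \<open>0\<close>; elsewhere the
  quantized root is a maximizer, hence \<open>\<omega> i\<close>. The word is thus the same for all
  \<open>z\<close> with this strict choice, however \<open>Q\<close> breaks ties.\<close>

lemma quantized_solution_strict_choice:
  assumes "phase_quantizer m Q" "strict_choice m n (\<lambda>i. B i $ 1) \<omega> z"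
  shows "quantized_solution Q n B z
    = Poly_Mapping.Abs_poly_mapping (\<lambda>i. if i < n then if B i $ 1 = 0 then Q 0 else \<omega> i else 0)"
proof -
  have "Q (z * B i $ 1) = (if B i $ 1 = 0 then Q 0 else \<omega> i)" if "i < n" for i
    using strict_choice_maximizer_unique[OF assms(2) that, of "Q (z * B i $ 1)"]
      phase_quantizer_maximizes[OF assms(1)] assms(1)
    by (auto simp: phase_quantizer_def)
  then show ?thesis
    unfolding quantized_solution_def by (intro arg_cong[where f = Poly_Mapping.Abs_poly_mapping]) auto
qed

theorem corollary5p3:
  fixes m :: nat
  assumes "3 \<le> m"
  shows
    "(\<forall>n. \<forall>B :: 'r::finite rows.
        real_dim (projected_polytope m n B) \<le> 2 * CARD('r) \<and>
        finite (vertices (projected_polytope m n B)) \<and>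
        card (vertices (projected_polytope m n B)) \<le> R_c (m * n) (real_dim (projected_polytope m n B)))
     \<and> (\<forall>d\<ge>1. (\<lambda>N. real (R_c N d)) \<in> O(\<lambda>N. real N ^ (d - 1)))
     \<and> (\<exists>C. \<forall>n\<ge>1. \<forall>B :: 'r rows.
          real (card (vertices (projected_polytope m n B))) \<le> C * real n ^ (2 * CARD('r) - 1) \<and>
          real (R_c (m * n) (real_dim (projected_polytope m n B))) \<le> C * real n ^ (2 * CARD('r) - 1))
     \<and> (\<forall>n. \<forall>B :: 1 rows.
          finite (phase_events (linear_maximizers m n B)) \<and>
          card (phase_events (linear_maximizers m n B)) \<le> m * n \<and>
          (\<forall>Q. phase_quantizer m Q \<longrightarrow>
             (\<forall>z. norm z = 1 \<longrightarrow> quantized_solution Q n B z \<in> linear_maximizers m n B z) \<and>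
             finite (phase_events (quantized_solution Q n B)) \<and>
             card (phase_events (quantized_solution Q n B)) \<le> m * n))"
proof (intro conjI allI impI)
  fix n :: nat and B :: "'r rows"
  show "real_dim (projected_polytope m n B) \<le> 2 * CARD('r)"
    using real_dim_le_DIM[of "projected_polytope m n B"] by (simp add: mult.commute)
  show "finite (vertices (projected_polytope m n B))"
    "card (vertices (projected_polytope m n B)) \<le> R_c (m * n) (real_dim (projected_polytope m n B))"
    using card_vertices_le[OF assms] by auto
next
  fix d :: nat
  show "(\<lambda>N. real (R_c N d)) \<in> O(\<lambda>N. real N ^ (d - 1))"
    by (rule R_c_bigo)
next
  let ?D = "2 * CARD('r)"
  \<comment> \<open>The constant of \<open>R_c_le_power_uniform\<close> with \<open>D\<close> the
    real dimension of the ambient space; it depends on \<open>m\<close> and \<open>CARD('r)\<close>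
    only.\<close>
  let ?C = "2 * real (Suc ?D) * real m ^ (?D - 1)"
  show "\<exists>C. \<forall>n\<ge>1. \<forall>B :: 'r rows.
      real (card (vertices (projected_polytope m n B))) \<le> C * real n ^ (?D - 1) \<and>
      real (R_c (m * n) (real_dim (projected_polytope m n B))) \<le> C * real n ^ (?D - 1)"
  proof (intro exI[of _ ?C] allI impI)
    fix n :: nat and B :: "'r rows"
    assume n: "1 \<le> n"
    have "real_dim (projected_polytope m n B) \<le> ?D"
      using real_dim_le_DIM[of "projected_polytope m n B"] by (simp add: mult.commute)
    then have "real (R_c (m * n) (real_dim (projected_polytope m n B))) \<le> ?C * real n ^ (?D - 1)"
      using assms n by (intro R_c_le_power_uniform) auto
    moreover have "real (card (vertices (projected_polytope m n B)))
        \<le> real (R_c (m * n) (real_dim (projected_polytope m n B)))"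
      using card_vertices_le(2)[OF assms] by (rule of_nat_mono)
    ultimately show "real (card (vertices (projected_polytope m n B))) \<le> ?C * real n ^ (?D - 1) \<and>
      real (R_c (m * n) (real_dim (projected_polytope m n B))) \<le> ?C * real n ^ (?D - 1)"
      by linarith
  qed
next
  fix n :: nat and B :: "1 rows"
  show "finite (phase_events (linear_maximizers m n B))"
    "card (phase_events (linear_maximizers m n B)) \<le> m * n"
    using phase_events_bound[OF assms, of n "\<lambda>i. B i $ 1" "linear_maximizers m n B"]
    by (simp_all add: linear_maximizers_strict_choice)
  fix Q :: "complex \<Rightarrow> complex"
  assume Q: "phase_quantizer m Q"
  then show "quantized_solution Q n B z \<in> linear_maximizers m n B z" for z
    by (rule quantized_solution_maximizes)
  show "finite (phase_events (quantized_solution Q n B))"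
    "card (phase_events (quantized_solution Q n B)) \<le> m * n"
    using phase_events_bound[OF assms, of n "\<lambda>i. B i $ 1" "quantized_solution Q n B"]
    by (simp_all add: quantized_solution_strict_choice[OF Q])
qed

end
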